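(* Let $p\ge 4$ be a real number. For any connected graph $G$ of order $n\ge 4$, we have \[ \mathcal{E}_p^+(G) \ge \left(\frac{4}{3}\right)^{p/4} n.\]
   Context: Graphs are finite, simple and undirected; the order of a graph is its number of vertices. For a graph $G$ of order $n$ with adjacency matrix $A(G)$ having (real) eigenvalues $\lambda_1\ge\cdots\ge\lambda_n$ counted with multiplicity, and a real number $p\ge 1$, the positive $p$-energy of $G$ is \[\mathcal{E}_p^+(G)=\sum_{i:\,\lambda_i>0}\lambda_i^p .\] *)

theory Defs
  imports
    Complex_Main
    "Graph_Theory.Graph_Theory"
    "Jordan_Normal_Form.Char_Poly"
begin

definition adjacency_matrix :: "('a, 'b) pre_digraph \<Rightarrow> 'a list \<Rightarrow> real mat" where
  "adjacency_matrix G vs =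
     mat (length vs) (length vs) (\<lambda>(i, j). if vs ! i \<rightarrow>\<^bsub>G\<^esub> vs ! j then 1 else 0)"

definition vertex_list :: "('a, 'b) pre_digraph \<Rightarrow> 'a list" where
  "vertex_list G = (SOME vs. distinct vs \<and> set vs = verts G)"

text \<open>
  The vertex ordering chosen here is immaterial, see \<open>graph_eigenvalues_eq\<close> below.  Multiplicities are
  those of the roots of the characteristic polynomial; only real roots are collected, but
  for a symmetric matrix these are all roots.
\<close>

definition graph_eigenvalues :: "('a, 'b) pre_digraph \<Rightarrow> real multiset" where
  "graph_eigenvalues G = proots (char_poly (adjacency_matrix G (vertex_list G)))"

definition positive_energy :: "real \<Rightarrow> ('a, 'b) pre_digraph \<Rightarrow> real" where
  "positive_energy p G = (\<Sum>x\<in>#filter_mset (\<lambda>x. x > 0) (graph_eigenvalues G). x powr p)"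

lemma vertex_list:
  assumes "finite (verts G)"
  shows "distinct (vertex_list G)" "set (vertex_list G) = verts G"
proof -
  have "\<exists>vs. distinct vs \<and> set vs = verts G"
    using finite_distinct_list[OF assms] by blast
  from someI_ex[OF this]
  show "distinct (vertex_list G)" "set (vertex_list G) = verts G"
    unfolding vertex_list_def by auto
qed

lemma char_poly_adjacency_matrix_permute:
  assumes "mset vs = mset ws"
  shows "char_poly (adjacency_matrix G vs) = char_poly (adjacency_matrix G ws)"
proof (rule char_poly_similar)
  define n where "n = length ws"
  obtain f where f: "f permutes {..<n}" and vs: "permute_list f ws = vs"
    using mset_eq_permutation[OF assms] unfolding n_def by blast
  have len: "length vs = n"
    using vs by (auto simp: n_def)
  have nth: "vs ! i = ws ! f i" if "i < n" for i
    using that f vs permute_list_nth[of f ws i] by (simp add: n_def)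
  have fn: "f i < n" if "i < n" for i
    using permutes_in_image[OF f, of i] that by simp
  have inj: "f i = f j \<longleftrightarrow> i = j" for i j
    using permutes_inj[OF f] by (auto dest: injD)
  define P :: "real mat" where "P = mat n n (\<lambda>(i, j). if j = f i then 1 else 0)"
  define Q :: "real mat" where "Q = mat n n (\<lambda>(i, j). if i = f j then 1 else 0)"
  let ?A = "adjacency_matrix G vs" and ?B = "adjacency_matrix G ws"
  have PQ: "P * Q = 1\<^sub>m n"
    by (rule eq_matI)
       (auto simp: P_def Q_def scalar_prod_def fn inj if_distrib[of "\<lambda>x. x * _"] sum.delta cong: if_cong)
  have QP: "Q * P = 1\<^sub>m n"
    using mat_mult_left_right_inverse[OF _ _ PQ] by (auto simp: P_def Q_def)
  have PB: "P * ?B = mat n n (\<lambda>(i, j). if ws ! f i \<rightarrow>\<^bsub>G\<^esub> ws ! j then 1 else 0)"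
    by (rule eq_matI)
       (auto simp: P_def adjacency_matrix_def n_def[symmetric] scalar_prod_def fn
          if_distrib[of "\<lambda>x. x * _"] sum.delta cong: if_cong)
  have "P * ?B * Q = mat n n (\<lambda>(i, j). if ws ! f i \<rightarrow>\<^bsub>G\<^esub> ws ! f j then 1 else 0)"
    unfolding PB
    by (rule eq_matI)
       (auto simp: Q_def scalar_prod_def fn if_distrib[of "\<lambda>x. _ * x"] sum.delta cong: if_cong)
  also have "\<dots> = ?A"
    by (rule eq_matI) (auto simp: adjacency_matrix_def len nth)
  finally have "similar_mat_wit ?A ?B P Q"
    using PQ QP unfolding similar_mat_wit_def Let_def
    by (auto simp: adjacency_matrix_def len n_def[symmetric] P_def Q_def)
  then show "similar_mat ?A ?B"
    unfolding similar_mat_def by blast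
qed

lemma graph_eigenvalues_eq:
  assumes "distinct vs" "set vs = verts G"
  shows "graph_eigenvalues G = proots (char_poly (adjacency_matrix G vs))"
proof -
  have "finite (verts G)"
    using assms by (metis finite_set)
  then have "mset (vertex_list G) = mset vs"
    using assms vertex_list[of G] by (metis set_eq_iff_mset_eq_distinct)
  then show ?thesis
    unfolding graph_eigenvalues_def by (metis char_poly_adjacency_matrix_permute)
qed

end

theory Submission
  imports Defs "HOL-Library.Disjoint_Sets"
begin

text \<open>
  The positive energy is bounded from below by local contributions.  If the vertex set is
  partitioned and every part \<open>S\<close> carries a unit vector whose Rayleigh quotient \<open>\<mu>\<close> for the adjacency
  matrix is positive, then the sum of all \<open>\<mu> powr p\<close> is at most the positive \<open>p\<close>-energy
  (\<open>sum_powr_rayleigh_le_positive_power_sum\<close>); this is Jensen's inequality in an eigenbasis.  It is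
  therefore enough to find a partition with \<open>\<mu> ^ 4 \<ge> 4 / 3 * card S\<close> for every part, because then
  \<open>\<mu> powr p \<ge> (4 / 3 * card S) powr (p / 4) \<ge> (4 / 3) powr (p / 4) * card S\<close>; the last step
  uses \<open>p / 4 \<ge> 1\<close> and \<open>card S \<ge> 1\<close>.

  A star with at least two leaves has such a vector, but not every connected graph can be
  partitioned into such stars, as the path on four vertices shows.  So some edges of the stars are
  subdivided: a spider is a centre with at least two legs of length one or two.  All spiders have a
  good test vector (\<open>spider_rayleigh_bound\<close>), and since nonnegative test vectors only profit from
  additional edges, the spiders need not be induced subgraphs.  Every connected graph with at least
  three vertices is partitioned by spiders (\<open>connected_spider_partition\<close>): a vertex adjacent to a
  spider can always be absorbed, if necessary by breaking the spider in two.

  The eigenbasis comes from the spectral theorem for real symmetric matrices, proved here by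
  deflation with Householder reflections.
\<close>

section \<open>Spectral theorem for real symmetric matrices\<close>

text \<open>
  The characteristic polynomial has a complex root \<open>z\<close>, and for a complex eigenvector \<open>v\<close> the
  Hermitian form of the matrix at \<open>v\<close> is both real and \<open>z\<close> times the squared norm of \<open>v\<close>.  So
  \<open>z\<close> is real and is a root of the real characteristic polynomial.
\<close>

lemma symmetric_mat_has_eigenvector:
  fixes A :: "real mat"
  assumes A: "A \<in> carrier_mat n n" and sym: "transpose_mat A = A" and n: "n > 0"
  obtains v e where "eigenvector A v e"
proof -
  let ?C = "map_mat of_real A :: complex mat"
  have C: "?C \<in> carrier_mat n n" using A by simp
  have A_sym: "A $$ (i, j) = A $$ (j, i)" if "i < n" "j < n" for i j
    using that A index_transpose_mat(1)[of i A j] sym by auto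
  obtain zs where zs: "char_poly ?C = (\<Prod>z\<leftarrow>zs. [:- z, 1:])" "length zs = n"
    using char_poly_factorized[OF C] by blast
  then obtain z zs' where "zs = z # zs'" using n by (cases zs) auto
  then have root: "poly (char_poly ?C) z = 0" unfolding zs by simp
  then obtain v where v: "v \<in> carrier_vec n" "v \<noteq> 0\<^sub>v n" "?C *\<^sub>v v = z \<cdot>\<^sub>v v"
    using eigenvalue_root_char_poly[OF C] C by (auto simp: eigenvalue_def eigenvector_def)
  have row: "(\<Sum>j<n. of_real (A $$ (i, j)) * v $ j) = z * v $ i" if i: "i < n" for i
  proof -
    have "(?C *\<^sub>v v) $ i = (z \<cdot>\<^sub>v v) $ i" using v(3) by simp
    then show ?thesis using i v(1) A by (simp add: scalar_prod_def atLeast0LessThan)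
  qed
  define Q where "Q = (\<Sum>i<n. \<Sum>j<n. of_real (A $$ (i, j)) * v $ j * cnj (v $ i))"
  define N where "N = (\<Sum>i<n. (cmod (v $ i))\<^sup>2)"
  have "Q = (\<Sum>i<n. (\<Sum>j<n. of_real (A $$ (i, j)) * v $ j) * cnj (v $ i))"
    unfolding Q_def by (simp add: sum_distrib_right)
  also have "\<dots> = (\<Sum>i<n. z * v $ i * cnj (v $ i))"
    by (rule sum.cong) (auto simp: row)
  also have "\<dots> = z * of_real N"
    unfolding N_def by (simp add: sum_distrib_left complex_norm_square[symmetric] mult.assoc)
  finally have Q: "Q = z * of_real N" .
  have "cnj Q = (\<Sum>i<n. \<Sum>j<n. of_real (A $$ (j, i)) * v $ i * cnj (v $ j))"
    unfolding Q_def by (auto intro!: sum.cong simp: A_sym)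
  also have "\<dots> = Q" unfolding Q_def by (rule sum.swap)
  finally have "cnj z * of_real N = z * of_real N" unfolding Q by simp
  moreover have "N \<noteq> 0"
  proof
    assume "N = 0"
    then have "\<forall>i<n. v $ i = 0" unfolding N_def by (simp add: sum_nonneg_eq_0_iff)
    then have "v = 0\<^sub>v n" using v(1) by auto
    with v(2) show False by simp
  qed
  ultimately have "cnj z = z" by simp
  then have "z = of_real (Re z)" by (simp add: complex_eq_iff)
  then have "poly (map_poly of_real (char_poly A)) (of_real (Re z) :: complex) = 0"
    using root of_real_hom.char_poly_hom[OF A] by metis
  then have "poly (char_poly A) (Re z) = 0" by (simp add: of_real_hom.poly_map_poly)
  then show thesis
    using that eigenvalue_root_char_poly[OF A, of "Re z"] by (auto simp: eigenvalue_def)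
qed

text \<open>
  The reflection in the hyperplane orthogonal to \<open>e\<^sub>0 - v\<close> exchanges the first basis vector \<open>e\<^sub>0\<close>
  with \<open>v\<close>.  It provides an orthogonal matrix with a prescribed first column, so that no
  orthonormal basis has to be completed.
\<close>

lemma householder_reflection:
  fixes v :: "nat \<Rightarrow> real"
  assumes unit: "(\<Sum>i<n. (v i)\<^sup>2) = 1"
  obtains H where "H \<in> carrier_mat n n" "transpose_mat H = H" "H * H = 1\<^sub>m n"
    "\<And>i. i < n \<Longrightarrow> H $$ (i, 0) = v i"
proof -
  have n: "n > 0" using unit by (cases n) auto
  define w where "w i = (if i = 0 then 1 else 0) - v i" for i
  define N where "N = (\<Sum>i<n. w i * w i)"
  have v0: "(\<Sum>i<n. (if i = 0 then 1 else 0) * v i) = v 0"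
    using n by (simp add: if_distrib[of "\<lambda>x. x * _"] sum.delta cong: if_cong)
  have one: "(\<Sum>i<n. (if i = 0 then 1 else 0) * (if i = 0 then 1 else 0)) = (1::real)"
    using n by (simp add: if_distrib[of "\<lambda>x. x * _"] sum.delta cong: if_cong)
  have "N = (\<Sum>i<n. (if i = 0 then 1 else 0) * (if i = 0 then 1 else 0)
      - 2 * ((if i = 0 then 1 else 0) * v i) + (v i)\<^sup>2)"
    unfolding N_def w_def by (rule sum.cong) (auto simp: power2_eq_square algebra_simps)
  also have "\<dots> = 2 - 2 * v 0"
    unfolding sum.distrib sum_subtractf sum_distrib_left[symmetric] v0 one unit by simp
  finally have N: "N = 2 * w 0" by (simp add: w_def)
  define c where "c = 2 / N"
  \<comment> \<open>If \<open>w = 0\<close> then \<open>c = 0\<close> and the matrix is the identity, as it should be.\<close>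
  define H where "H = mat n n (\<lambda>(i, j). (if i = j then 1 else 0) - c * w i * w j)"
  have cN: "c * c * N = 2 * c" by (simp add: c_def)
  show thesis
  proof
    show "H \<in> carrier_mat n n" "transpose_mat H = H"
      by (auto simp: H_def mult.commute mult.left_commute intro!: eq_matI)
    show "H * H = 1\<^sub>m n"
    proof (rule eq_matI)
      fix i j assume "i < dim_row (1\<^sub>m n)" "j < dim_col (1\<^sub>m n)"
      then have ij: "i < n" "j < n" by auto
      have "(H * H) $$ (i, j) = (\<Sum>k<n. ((if i = k then 1 else 0) - c * w i * w k)
          * ((if k = j then 1 else 0) - c * w k * w j))"
        using ij by (simp add: H_def scalar_prod_def atLeast0LessThan)
      also have "\<dots> = (\<Sum>k<n. (if k = i then (if i = j then 1 else 0) - c * w i * w j else 0)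
          - (if k = j then c * w i * w j else 0) + c * c * w i * w j * (w k * w k))"
        by (rule sum.cong) (auto simp: algebra_simps)
      also have "\<dots> = (if i = j then 1 else 0) - 2 * c * w i * w j + c * c * w i * w j * N"
        using ij by (simp add: sum.distrib sum_subtractf sum_distrib_left N_def)
      also have "c * c * w i * w j * N = 2 * c * w i * w j"
        using cN by (metis (no_types, opaque_lifting) mult.assoc mult.commute)
      finally show "(H * H) $$ (i, j) = 1\<^sub>m n $$ (i, j)" using ij by simp
    qed (auto simp: H_def)
    show "H $$ (i, 0) = v i" if i: "i < n" for i
    proof (cases "N = 0")
      case True
      then have "w i * w i = 0"
        using i unfolding N_def by (subst (asm) sum_nonneg_eq_0_iff) auto
      with True show ?thesis using i n by (auto simp: H_def c_def w_def)
    next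
      case False
      then have "c * w 0 = 1" by (simp add: c_def N)
      moreover have "H $$ (i, 0) = (if i = 0 then 1 else 0) - (c * w 0) * w i"
        using i n by (simp add: H_def)
      ultimately show ?thesis by (simp add: w_def)
    qed
  qed
qed

lemma conjugate_diagonalisation:
  fixes H U D :: "real mat"
  assumes "H \<in> carrier_mat n n" "U \<in> carrier_mat n n" "D \<in> carrier_mat n n"
  shows "H * (U * D * transpose_mat U) * transpose_mat H = (H * U) * D * transpose_mat (H * U)"
  using assms by (simp add: transpose_mult[of _ n n _ n] assoc_mult_mat[of _ n n _ n _ n])

text \<open>
  Conjugating with a reflection that sends the first basis vector to a unit eigenvector splits the
  eigenvalue off as a one by one block, and induction applies to the remaining symmetric block.
\<close>

theorem real_spectral_theorem:
  fixes A :: "real mat"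
  assumes "A \<in> carrier_mat n n" "transpose_mat A = A"
  shows "\<exists>U d. U \<in> carrier_mat n n \<and> U * transpose_mat U = 1\<^sub>m n
    \<and> A = U * mat_diag n d * transpose_mat U"
  using assms
proof (induction n arbitrary: A)
  case 0
  then show ?case by (intro exI[of _ "1\<^sub>m 0"]) (auto intro!: eq_matI)
next
  case (Suc n)
  note A = Suc.prems(1)
  obtain v0 e where v0: "eigenvector A v0 e"
    using symmetric_mat_has_eigenvector[OF Suc.prems] by blast
  define N where "N = (\<Sum>i<Suc n. (v0 $ i)\<^sup>2)"
  have "N \<noteq> 0"
  proof
    assume "N = 0"
    then have "\<forall>i<Suc n. v0 $ i = 0" unfolding N_def by (subst (asm) sum_nonneg_eq_0_iff) auto
    then have "v0 = 0\<^sub>v (Suc n)" using v0 A by (auto simp: eigenvector_def)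
    with v0 A show False by (auto simp: eigenvector_def)
  qed
  moreover have "N \<ge> 0" unfolding N_def by (intro sum_nonneg) auto
  ultimately have N: "N > 0" by simp
  define v where "v = vec (Suc n) (\<lambda>i. v0 $ i / sqrt N)"
  have v: "v = (1 / sqrt N) \<cdot>\<^sub>v v0" using v0 A by (auto simp: v_def eigenvector_def)
  have v_carrier: "v \<in> carrier_vec (Suc n)" by (simp add: v_def)
  have Av: "A *\<^sub>v v = e \<cdot>\<^sub>v v"
    using v0 A unfolding v by (auto simp: eigenvector_def smult_smult_assoc mult.commute
        mult_mat_vec[of _ "Suc n" "Suc n"])
  have "(\<Sum>i<Suc n. (v $ i)\<^sup>2) = (\<Sum>i<Suc n. (v0 $ i)\<^sup>2 / N)"
    by (rule sum.cong) (use N in \<open>auto simp: v_def power_divide\<close>)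
  also have "\<dots> = 1" using N by (simp add: sum_divide_distrib[symmetric] N_def[symmetric] del: sum.lessThan_Suc)
  finally obtain H where H: "H \<in> carrier_mat (Suc n) (Suc n)" "transpose_mat H = H"
      "H * H = 1\<^sub>m (Suc n)" "\<And>i. i < Suc n \<Longrightarrow> H $$ (i, 0) = v $ i"
    using householder_reflection[where n = "Suc n" and v = "\<lambda>i. v $ i"] by metis
  have colH: "col H 0 = v" using H by (auto simp: v_def)
  define B where "B = H * A * H"
  have B: "B \<in> carrier_mat (Suc n) (Suc n)" using H(1) A by (auto simp: B_def)
  have "transpose_mat B = B" unfolding B_def
    using H A Suc.prems(2)
    by (simp add: transpose_mult[of _ "Suc n" "Suc n" _ "Suc n"] assoc_mult_mat[of _ "Suc n" "Suc n" _ "Suc n" _ "Suc n"])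
  then have B_sym: "B $$ (i, j) = B $$ (j, i)" if "i < Suc n" "j < Suc n" for i j
    using that B index_transpose_mat(1)[of i B j] by auto
  have "col B 0 = (H * A) *\<^sub>v v"
    unfolding B_def colH[symmetric] by (rule col_mult2) (use H(1) A in auto)
  also have "\<dots> = H *\<^sub>v (A *\<^sub>v v)"
    by (rule assoc_mult_mat_vec) (use H(1) A v_carrier in auto)
  also have "\<dots> = e \<cdot>\<^sub>v (H *\<^sub>v v)"
    unfolding Av by (rule mult_mat_vec) (use H(1) v_carrier in auto)
  also have "H *\<^sub>v v = col (H * H) 0"
    unfolding colH[symmetric] by (rule col_mult2[symmetric]) (use H(1) in auto)
  finally have "col B 0 = e \<cdot>\<^sub>v unit_vec (Suc n) 0" using H(3) by simp
  then have B0: "B $$ (i, 0) = (if i = 0 then e else 0)" if "i < Suc n" for i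
  proof -
    have "B $$ (i, 0) = col B 0 $ i" using that B by simp
    also have "\<dots> = (if i = 0 then e else 0)"
      unfolding \<open>col B 0 = e \<cdot>\<^sub>v unit_vec (Suc n) 0\<close> using that by simp
    finally show ?thesis .
  qed
  define B' where "B' = mat n n (\<lambda>(i, j). B $$ (Suc i, Suc j))"
  have B': "B' \<in> carrier_mat n n" "transpose_mat B' = B'"
    unfolding B'_def by (auto intro!: eq_matI B_sym)
  then obtain U d where U: "U \<in> carrier_mat n n" "U * transpose_mat U = 1\<^sub>m n"
      "B' = U * mat_diag n d * transpose_mat U"
    using Suc.IH by blast
  define W where "W = four_block_mat (1\<^sub>m 1) (0\<^sub>m 1 n) (0\<^sub>m n 1) U"
  have W: "W \<in> carrier_mat (Suc n) (Suc n)" using U(1) by (auto simp: W_def)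
  have tW: "transpose_mat W = four_block_mat (1\<^sub>m 1) (0\<^sub>m 1 n) (0\<^sub>m n 1) (transpose_mat U)"
    unfolding W_def using U(1) by (subst transpose_four_block_mat[of _ 1 1 _ n _ n]) auto
  define D where "D = mat_diag (Suc n) (case_nat e d)"
  have D: "D = four_block_mat (mat 1 1 (\<lambda>_. e)) (0\<^sub>m 1 n) (0\<^sub>m n 1) (mat_diag n d)"
    unfolding D_def by (rule eq_matI) (auto simp: mat_diag_def split: nat.splits)
  have WW: "W * transpose_mat W = 1\<^sub>m (Suc n)"
    unfolding tW unfolding W_def using U(1,2)
    by (subst mult_four_block_mat[of _ 1 1 _ n _ n _ _ 1 _ n]) auto
  have tU: "transpose_mat U \<in> carrier_mat n n" "U * mat_diag n d \<in> carrier_mat n n"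
    using U(1) by auto
  have WD: "W * D = four_block_mat (mat 1 1 (\<lambda>_. e)) (0\<^sub>m 1 n) (0\<^sub>m n 1) (U * mat_diag n d)"
    unfolding W_def D
    by (subst mult_four_block_mat[of _ 1 1 _ n _ n _ _ 1 _ n])
      (use U(1) tU in \<open>simp_all add: left_mult_zero_mat[OF mat_diag_dim]\<close>)
  have "W * D * transpose_mat W = four_block_mat (mat 1 1 (\<lambda>_. e)) (0\<^sub>m 1 n) (0\<^sub>m n 1) B'"
    unfolding WD tW U(3)
    by (subst mult_four_block_mat[of _ 1 1 _ n _ n _ _ 1 _ n])
      (use U(1) tU in \<open>simp_all add: right_mult_zero_mat[OF tU(2)]
        left_add_zero_mat[OF mult_carrier_mat[OF tU(2,1)]]\<close>)
  also have "\<dots> = B"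
    using B B0 B_sym by (intro eq_matI) (auto simp: B'_def)
  finally have BW: "B = W * D * transpose_mat W" by simp
  have "A = (H * H) * A * (H * H)" using A H(3) by simp
  also have "\<dots> = H * B * H" unfolding B_def using H(1) A by (simp add: assoc_mult_mat[of _ "Suc n" "Suc n" _ "Suc n" _ "Suc n"])
  also have "\<dots> = H * (W * D * transpose_mat W) * transpose_mat H" unfolding BW H(2) ..
  also have "\<dots> = (H * W) * D * transpose_mat (H * W)"
    by (rule conjugate_diagonalisation) (use H(1) W in \<open>auto simp: D_def\<close>)
  finally have 1: "A = (H * W) * D * transpose_mat (H * W)" .
  have 2: "(H * W) * transpose_mat (H * W) = H * (W * transpose_mat W) * H"
    using H(1,2) W by (simp add: transpose_mult[of _ "Suc n" "Suc n" _ "Suc n"] assoc_mult_mat[of _ "Suc n" "Suc n" _ "Suc n" _ "Suc n"])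
  show ?case
    using H(1) W 1 2 WW H(3) unfolding D_def by (intro exI[of _ "H * W"] exI) auto
qed

lemma proots_char_poly_diagonalisation:
  fixes U :: "real mat"
  assumes "U \<in> carrier_mat n n" "U * transpose_mat U = 1\<^sub>m n"
  shows "proots (char_poly (U * mat_diag n d * transpose_mat U)) = image_mset d (mset_set {..<n})"
proof -
  let ?A = "U * mat_diag n d * transpose_mat U"
  have "transpose_mat U * U = 1\<^sub>m n"
    using mat_mult_left_right_inverse[OF _ _ assms(2)] assms(1) by auto
  then have "similar_mat_wit ?A (mat_diag n d) U (transpose_mat U)"
    using assms mat_diag_dim[of n d] unfolding similar_mat_wit_def Let_def by auto
  then have "char_poly ?A = char_poly (mat_diag n d)"
    by (intro char_poly_similar) (auto simp: similar_mat_def)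
  also have "\<dots> = (\<Prod>a\<leftarrow>diag_mat (mat_diag n d). [:- a, 1:])"
    by (rule char_poly_upper_triangular[OF mat_diag_dim]) (auto simp: mat_diag_def)
  also have "diag_mat (mat_diag n d) = map d [0..<n]"
    by (auto simp: diag_mat_def mat_diag_def intro!: nth_equalityI)
  finally have "char_poly ?A = (\<Prod>a\<leftarrow>map d [0..<n]. [:- a, 1:])" .
  moreover have "proots (\<Prod>a\<leftarrow>as. [:- a, 1:]) = mset as" for as :: "real list"
  proof (induction as)
    case (Cons a as)
    have "(\<Prod>a\<leftarrow>as. [:- a, 1:]) \<noteq> 0" by (auto simp: prod_list_zero_iff)
    then show ?case using Cons by (simp add: proots_mult del: mult_pCons_left)
  qed simp
  ultimately show ?thesis
    by (simp only: mset_map mset_upt atLeast0LessThan)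
qed

section \<open>Positive powers of eigenvalues and orthonormal test vectors\<close>

lemma bernoulli_powr:
  fixes y p :: real
  assumes "y > 0" "p \<ge> 1"
  shows "1 + p * (y - 1) \<le> y powr p"
proof -
  have "1 - 1 / y \<le> ln y"
    using ln_le_minus_one[of "1 / y"] assms by (simp add: ln_div)
  then have "1 + (p - 1) * (1 - 1 / y) \<le> 1 + (p - 1) * ln y"
    using assms by (intro add_left_mono mult_left_mono) auto
  also have "\<dots> \<le> exp ((p - 1) * ln y)" by (rule exp_ge_add_one_self)
  also have "\<dots> = y powr (p - 1)" using assms by (simp add: powr_def)
  finally have "y * (1 + (p - 1) * (1 - 1 / y)) \<le> y * y powr (p - 1)"
    using assms by (intro mult_left_mono) auto
  also have "y * y powr (p - 1) = y powr p" using assms by (simp add: powr_diff)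
  also have "y * (1 + (p - 1) * (1 - 1 / y)) = 1 + p * (y - 1)"
    using assms by (simp add: field_simps)
  finally show ?thesis .
qed

text \<open>
  The function on the right is convex, and the left-hand side is its tangent at \<open>m\<close>.  In this form
  Jensen's inequality needs no more than the zeroth and first moments of the weights.
\<close>

lemma positive_power_above_tangent:
  fixes m p r :: real
  assumes "m > 0" "p \<ge> 1"
  shows "m powr p + p * m powr (p - 1) * (r - m) \<le> (if r > 0 then r powr p else 0)"
proof -
  define M where "M = m powr (p - 1)"
  have M: "M > 0" "m powr p = m * M" using assms by (auto simp: M_def powr_diff)
  show ?thesis
  proof (cases "r > 0")
    case True
    have "m powr p * (1 + p * (r / m - 1)) \<le> m powr p * (r / m) powr p"
      using bernoulli_powr[of "r / m" p] True assms by (intro mult_left_mono) auto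
    also have "\<dots> = r powr p" using assms True by (simp add: powr_divide)
    also have "m powr p * (1 + p * (r / m - 1)) = m powr p + p * M * (r - m)"
      using assms by (simp add: M(2) field_simps)
    finally show ?thesis using True by (simp flip: M_def)
  next
    case False
    then have "r * (p * M) \<le> 0" using M assms by (simp add: mult_nonpos_nonneg)
    moreover have "m * M \<le> p * (m * M)" 
      using mult_right_mono[of 1 p "m * M"] M(1) assms by simp
    moreover have "m * M + p * M * (r - m) = m * M + r * (p * M) - p * (m * M)"
      by (simp add: algebra_simps)
    ultimately have "m * M + p * M * (r - m) \<le> 0" by linarith
    then show ?thesis using False M(2) by (simp flip: M_def)
  qed
qed

text \<open>
  This is Peierls' inequality for the trace of a convex function.  Here \<open>U\<close> lists an orthonormal
  eigenbasis of \<open>M\<close>.  The squared coordinates of the unit vector \<open>x S\<close> in it are weights of total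
  mass one with mean \<open>\<mu> S\<close>, so Jensen's inequality bounds \<open>\<mu> S powr p\<close> by the weighted sum of the
  positive powers of the eigenvalues.  The vectors for different parts have disjoint
  supports, so they are orthonormal, and by Bessel's inequality every eigenvalue receives total
  weight at most one.
\<close>

lemma sum_powr_rayleigh_le_positive_power_sum:
  fixes M :: "'a \<Rightarrow> 'a \<Rightarrow> real" and x :: "'a set \<Rightarrow> 'a \<Rightarrow> real" and U :: "'a \<Rightarrow> 'j \<Rightarrow> real" and d :: "'j \<Rightarrow> real"
  defines "\<mu> \<equiv> \<lambda>S. \<Sum>u\<in>S. \<Sum>v\<in>S. M u v * x S u * x S v"
  assumes V: "finite V" "partition_on V P"
    and p: "p \<ge> 1"
    and M: "\<And>u v. u \<in> V \<Longrightarrow> v \<in> V \<Longrightarrow> M u v = (\<Sum>j\<in>J. d j * U u j * U v j)"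
    and rows: "\<And>u v. u \<in> V \<Longrightarrow> v \<in> V \<Longrightarrow> (\<Sum>j\<in>J. U u j * U v j) = of_bool (u = v)"
    and cols: "\<And>j. j \<in> J \<Longrightarrow> (\<Sum>v\<in>V. (U v j)\<^sup>2) \<le> 1"
    and unit: "\<And>S. S \<in> P \<Longrightarrow> (\<Sum>v\<in>S. (x S v)\<^sup>2) = 1"
    and pos: "\<And>S. S \<in> P \<Longrightarrow> \<mu> S > 0"
  shows "(\<Sum>S\<in>P. \<mu> S powr p) \<le> (\<Sum>j\<in>J. if d j > 0 then d j powr p else 0)"
proof -
  define f where "f r = (if r > 0 then r powr p else 0)" for r :: real
  define y where "y S j = (\<Sum>v\<in>S. U v j * x S v)" for S j
  have SV: "S \<subseteq> V" if "S \<in> P" for S using that V(2) by (auto simp: partition_on_def)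
  have fin_P: "finite P" using V finite_elements by blast
  have expand: "(\<Sum>j\<in>J. k j * (y S j)\<^sup>2)
      = (\<Sum>u\<in>S. \<Sum>v\<in>S. (\<Sum>j\<in>J. k j * U u j * U v j) * x S u * x S v)" for k S
  proof -
    have "(\<Sum>j\<in>J. k j * (y S j)\<^sup>2) = (\<Sum>j\<in>J. \<Sum>u\<in>S. \<Sum>v\<in>S. k j * U u j * U v j * x S u * x S v)"
      unfolding y_def power2_eq_square sum_product by (simp add: sum_distrib_left mult_ac)
    also have "\<dots> = (\<Sum>u\<in>S. \<Sum>j\<in>J. \<Sum>v\<in>S. k j * U u j * U v j * x S u * x S v)"
      by (rule sum.swap)
    also have "\<dots> = (\<Sum>u\<in>S. \<Sum>v\<in>S. \<Sum>j\<in>J. k j * U u j * U v j * x S u * x S v)"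
      by (intro sum.cong refl sum.swap)
    finally show ?thesis by (simp add: sum_distrib_right)
  qed
  have mean: "(\<Sum>j\<in>J. d j * (y S j)\<^sup>2) = \<mu> S" if S: "S \<in> P" for S
    unfolding expand \<mu>_def using SV[OF S] by (intro sum.cong refl) (simp add: M subsetD)
  have total: "(\<Sum>j\<in>J. (y S j)\<^sup>2) = 1" if S: "S \<in> P" for S
  proof -
    have "(\<Sum>j\<in>J. 1 * (y S j)\<^sup>2) = (\<Sum>u\<in>S. \<Sum>v\<in>S. of_bool (u = v) * x S u * x S v)"
      unfolding expand using SV[OF S] by (intro sum.cong refl) (simp add: rows subsetD)
    also have "\<dots> = (\<Sum>u\<in>S. (x S u)\<^sup>2)"
      using finite_subset[OF SV[OF S] V(1)]
      by (intro sum.cong refl) (simp add: of_bool_def if_distrib[of "\<lambda>x. x * _"] power2_eq_square cong: if_cong)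
    finally show ?thesis using unit[OF S] by simp
  qed
  have part: "\<mu> S powr p \<le> (\<Sum>j\<in>J. (y S j)\<^sup>2 * f (d j))" if S: "S \<in> P" for S
  proof -
    have "\<mu> S powr p = \<mu> S powr p * (\<Sum>j\<in>J. (y S j)\<^sup>2)
        + p * \<mu> S powr (p - 1) * ((\<Sum>j\<in>J. d j * (y S j)\<^sup>2) - \<mu> S * (\<Sum>j\<in>J. (y S j)\<^sup>2))"
      by (simp add: total[OF S] mean[OF S])
    also have "\<dots> = (\<Sum>j\<in>J. (y S j)\<^sup>2 * (\<mu> S powr p + p * \<mu> S powr (p - 1) * (d j - \<mu> S)))"
      by (simp add: sum_distrib_left sum.distrib sum_subtractf algebra_simps)
    also have "\<dots> \<le> (\<Sum>j\<in>J. (y S j)\<^sup>2 * f (d j))"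
      unfolding f_def using positive_power_above_tangent[OF pos[OF S] p]
      by (intro sum_mono mult_left_mono) auto
    finally show ?thesis .
  qed
  have bessel: "(\<Sum>S\<in>P. (y S j)\<^sup>2) \<le> 1" if j: "j \<in> J" for j
  proof -
    have "(\<Sum>S\<in>P. (y S j)\<^sup>2) \<le> (\<Sum>S\<in>P. \<Sum>v\<in>S. (U v j)\<^sup>2)"
    proof (rule sum_mono)
      fix S assume S: "S \<in> P"
      (* The j-th eigenvector, restricted to S, minus its projection onto x S. *)
      have "0 \<le> (\<Sum>v\<in>S. (U v j - y S j * x S v)\<^sup>2)" by (intro sum_nonneg) auto
      also have "\<dots> = (\<Sum>v\<in>S. (U v j)\<^sup>2) - 2 * y S j * (\<Sum>v\<in>S. U v j * x S v)
          + (y S j)\<^sup>2 * (\<Sum>v\<in>S. (x S v)\<^sup>2)"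
        by (simp add: power2_eq_square sum_distrib_left sum.distrib sum_subtractf algebra_simps)
      also have "\<dots> = (\<Sum>v\<in>S. (U v j)\<^sup>2) - (y S j)\<^sup>2"
        using unit[OF S] by (simp add: power2_eq_square flip: y_def)
      finally show "(y S j)\<^sup>2 \<le> (\<Sum>v\<in>S. (U v j)\<^sup>2)" by simp
    qed
    also have "\<dots> = (\<Sum>v\<in>V. (U v j)\<^sup>2)"
      using V SV finite_subset by (subst partition_onD1[OF V(2)], subst sum.Union_disjoint)
        (auto simp: partition_on_def disjoint_def)
    also have "\<dots> \<le> 1" by (rule cols[OF j])
    finally show ?thesis .
  qed
  have "(\<Sum>S\<in>P. \<mu> S powr p) \<le> (\<Sum>S\<in>P. \<Sum>j\<in>J. (y S j)\<^sup>2 * f (d j))"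
    using part by (rule sum_mono)
  also have "\<dots> = (\<Sum>j\<in>J. (\<Sum>S\<in>P. (y S j)\<^sup>2) * f (d j))"
    unfolding sum_distrib_right by (rule sum.swap)
  also have "\<dots> \<le> (\<Sum>j\<in>J. 1 * f (d j))"
    using bessel by (intro sum_mono mult_right_mono) (auto simp: f_def)
  finally show ?thesis by (simp add: f_def)
qed

section \<open>Test vectors on spiders\<close>

text \<open>
  A tree of radius at most two around \<open>c\<close>, seen as a (not necessarily induced) subgraph of
  the graph with adjacency \<open>E\<close>: the legs in \<open>A\<close> have length one, and a leg in \<open>B\<close> starts at
  \<open>y\<close> and ends at \<open>g y\<close>.  At least two legs are demanded so that a path on three vertices
  always counts as a star around its middle vertex, and single edges, whose eigenvalue is too
  small, are excluded.
\<close>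

definition spider :: "('a \<Rightarrow> 'a \<Rightarrow> bool) \<Rightarrow> 'a \<Rightarrow> 'a set \<Rightarrow> 'a set \<Rightarrow> ('a \<Rightarrow> 'a) \<Rightarrow> 'a set \<Rightarrow> bool" where
  "spider E c A B g S \<longleftrightarrow>
     finite A \<and> finite B \<and> c \<notin> A \<union> B \<and> A \<inter> B = {} \<and> inj_on g B \<and> g ` B \<inter> insert c (A \<union> B) = {} \<and>
     (\<forall>y\<in>A \<union> B. E c y) \<and> (\<forall>y\<in>B. E y (g y)) \<and> card A + card B \<ge> 2 \<and>
     S = insert c (A \<union> B \<union> g ` B)"

definition is_spider :: "('a \<Rightarrow> 'a \<Rightarrow> bool) \<Rightarrow> 'a set \<Rightarrow> bool" where
  "is_spider E S \<longleftrightarrow> (\<exists>c A B g. spider E c A B g S)"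

lemma is_spiderI: "spider E c A B g S \<Longrightarrow> is_spider E S"
  by (auto simp: is_spider_def)

lemma sum_spider:
  fixes f :: "'a \<Rightarrow> 'b::comm_monoid_add"
  assumes "spider E c A B g S"
  shows "sum f S = f c + sum f A + sum f B + sum (\<lambda>y. f (g y)) B"
proof -
  have "sum f S = f c + sum f (A \<union> B \<union> g ` B)"
    using assms by (auto simp: spider_def)
  also have "sum f (A \<union> B \<union> g ` B) = sum f A + sum f B + sum f (g ` B)"
    using assms unfolding spider_def by (subst sum.union_disjoint | blast | simp)+
  also have "sum f (g ` B) = sum (\<lambda>y. f (g y)) B"
    using assms by (subst sum.reindex) (auto simp: spider_def)
  finally show ?thesis by (simp add: add.assoc)
qed

lemma card_spider:
  assumes "spider E c A B g S"
  shows "card S = 1 + card A + 2 * card B"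
  using sum_spider[OF assms, of "\<lambda>_. 1 :: nat"] by simp

text \<open>
  The test vectors take the value \<open>a\<close> at the centre, \<open>b\<close> on the short legs, and \<open>s\<close> and \<open>t\<close> on
  the inner and outer vertices of the long legs.  Further edges of the graph between vertices of
  \<open>S\<close> can only increase the quadratic form, since the weights are nonnegative.
\<close>

lemma spider_quadratic_form_ge:
  fixes a b s t :: real
  defines "x \<equiv> \<lambda>A B c v. if v = c then a else if v \<in> A then b else if v \<in> B then s else t"
  assumes sp: "spider E c A B g S" and sym: "symp E"
    and nonneg: "a \<ge> 0" "b \<ge> 0" "s \<ge> 0" "t \<ge> 0"
  shows "(\<Sum>v\<in>S. (x A B c v)\<^sup>2) = a\<^sup>2 + card A * b\<^sup>2 + card B * (s\<^sup>2 + t\<^sup>2)"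
    and "(\<Sum>u\<in>S. \<Sum>v\<in>S. of_bool (E u v) * x A B c u * x A B c v)
      \<ge> 2 * (card A * (a * b) + card B * (a * s + s * t))"
proof -
  note E_sym = sympD[OF sym]
  define y where "y = x A B c"
  have y_nonneg: "y v \<ge> 0" for v using nonneg by (auto simp: y_def x_def)
  have yc: "y c = a" by (simp add: y_def x_def)
  have yA: "y v = b" if "v \<in> A" for v using that sp by (auto simp: y_def x_def spider_def)
  have yB: "y v = s" if "v \<in> B" for v using that sp by (auto simp: y_def x_def spider_def)
  have yg: "y (g v) = t" if "v \<in> B" for v using that sp by (auto simp: y_def x_def spider_def)
  have "(\<Sum>v\<in>S. (y v)\<^sup>2) = a\<^sup>2 + card A * b\<^sup>2 + card B * (s\<^sup>2 + t\<^sup>2)"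
    by (simp add: sum_spider[OF sp] yc yA yB yg algebra_simps)
  then show "(\<Sum>v\<in>S. (x A B c v)\<^sup>2) = a\<^sup>2 + card A * b\<^sup>2 + card B * (s\<^sup>2 + t\<^sup>2)"
    by (simp add: y_def)
  define r where "r u = (\<Sum>v\<in>S. of_bool (E u v) * y v)" for u
  have fin: "finite S" using sp by (auto simp: spider_def)
  (* Discarding all neighbours of u but those in T loses only nonnegative terms. *)
  have r_ge: "r u \<ge> sum y T" if "T \<subseteq> S" "\<And>v. v \<in> T \<Longrightarrow> E u v" for u T
  proof -
    have "sum y T = (\<Sum>v\<in>T. of_bool (E u v) * y v)" using that by (intro sum.cong) auto
    also have "\<dots> \<le> r u" unfolding r_def
      using that fin y_nonneg by (intro sum_mono2) auto
    finally show ?thesis .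
  qed
  have rc: "r c \<ge> card A * b + card B * s"
  proof -
    have "sum y (A \<union> B) = sum y A + sum y B"
      using sp by (intro sum.union_disjoint) (auto simp: spider_def)
    also have "\<dots> = card A * b + card B * s" by (simp add: yA yB)
    finally show ?thesis using r_ge[of "A \<union> B" c] sp by (auto simp: spider_def)
  qed
  have rA: "r v \<ge> a" if "v \<in> A" for v
    using r_ge[of "{c}" v] sp that yc E_sym by (auto simp: spider_def)
  have rB: "r v \<ge> a + t" if "v \<in> B" for v
  proof -
    have "c \<noteq> g v" using sp that by (auto simp: spider_def)
    then have "sum y {c, g v} = a + t" using that by (simp add: yc yg)
    moreover have "{c, g v} \<subseteq> S" "E v c" "E v (g v)"
      using sp that E_sym by (auto simp: spider_def)
    ultimately show ?thesis using r_ge[of "{c, g v}" v] by auto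
  qed
  have rg: "r (g v) \<ge> s" if "v \<in> B" for v
    using r_ge[of "{v}" "g v"] sp that yB E_sym by (auto simp: spider_def)
  have "2 * (card A * (a * b) + card B * (a * s + s * t))
      = a * (card A * b + card B * s) + (\<Sum>v\<in>A. b * a) + (\<Sum>v\<in>B. s * (a + t)) + (\<Sum>v\<in>B. t * s)"
    by (simp add: algebra_simps)
  also have "\<dots> \<le> y c * r c + (\<Sum>v\<in>A. y v * r v) + (\<Sum>v\<in>B. y v * r v) + (\<Sum>v\<in>B. y (g v) * r (g v))"
    using rc rA rB rg nonneg by (intro add_mono sum_mono) (auto simp: yc yA yB yg intro!: mult_left_mono)
  also have "\<dots> = (\<Sum>u\<in>S. y u * r u)" by (simp add: sum_spider[OF sp])
  also have "\<dots> = (\<Sum>u\<in>S. \<Sum>v\<in>S. of_bool (E u v) * y u * y v)"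
    unfolding r_def by (simp add: sum_distrib_left mult.commute mult.left_commute)
  finally show "(\<Sum>u\<in>S. \<Sum>v\<in>S. of_bool (E u v) * x A B c u * x A B c v)
      \<ge> 2 * (card A * (a * b) + card B * (a * s + s * t))"
    by (simp add: y_def)
qed

lemma unit_vector_of_rayleigh_quotient:
  fixes x :: "'a \<Rightarrow> real" and M :: "'a \<Rightarrow> 'a \<Rightarrow> real"
  assumes "N > 0" "(\<Sum>v\<in>S. (x v)\<^sup>2) = N" "(\<Sum>u\<in>S. \<Sum>v\<in>S. M u v * x u * x v) \<ge> m * N"
  shows "\<exists>z. (\<Sum>v\<in>S. (z v)\<^sup>2) = 1 \<and> (\<Sum>u\<in>S. \<Sum>v\<in>S. M u v * z u * z v) \<ge> m"
proof (intro exI conjI)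
  define z where "z v = x v / sqrt N" for v
  have "(\<Sum>v\<in>S. (z v)\<^sup>2) = (\<Sum>v\<in>S. (x v)\<^sup>2 / N)"
    using assms(1) by (simp add: z_def power_divide)
  then show "(\<Sum>v\<in>S. (z v)\<^sup>2) = 1" using assms by (simp flip: sum_divide_distrib)
  have "(\<Sum>u\<in>S. \<Sum>v\<in>S. M u v * z u * z v) = (\<Sum>u\<in>S. \<Sum>v\<in>S. M u v * x u * x v / N)"
    using assms(1) by (simp add: z_def)
  also have "\<dots> = (\<Sum>u\<in>S. \<Sum>v\<in>S. M u v * x u * x v) / N"
    by (simp flip: sum_divide_distrib)
  finally show "(\<Sum>u\<in>S. \<Sum>v\<in>S. M u v * z u * z v) \<ge> m"
    using assms by (simp add: pos_le_divide_eq)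
qed

text \<open>
  Let \<open>d\<close> be the number of legs.  The principal eigenvector of the star formed by the centre and
  its \<open>d\<close> neighbours has Rayleigh quotient \<open>\<surd>d\<close>, which suffices unless
  \<open>3 * d\<^sup>2 < 4 * card S\<close>.  As \<open>card S \<le> 2 * d + 1\<close>, only the paths on four and on five vertices
  and the spider with three long legs are left; weights close to their principal eigenvectors
  give the quotients 8/5, 12/7 and 2.  The constant 4/3 is attained by the star with two leaves.
\<close>

lemma spider_rayleigh_bound:
  assumes sp: "spider E c A B g S" and sym: "symp E"
  obtains x where "(\<Sum>v\<in>S. (x v)\<^sup>2) = (1::real)"
    "(\<Sum>u\<in>S. \<Sum>v\<in>S. of_bool (E u v) * x u * x v) > 0"
    "(\<Sum>u\<in>S. \<Sum>v\<in>S. of_bool (E u v) * x u * x v) ^ 4 \<ge> 4 / 3 * card S"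
proof -
  define d where "d = card A + card B"
  have d: "d \<ge> 2" using sp by (simp add: spider_def d_def)
  have S: "card S = 1 + d + card B" using card_spider[OF sp] by (simp add: d_def)
  note result = that
  have conclude: thesis if w: "a \<ge> 0" "b \<ge> 0" "s \<ge> 0" "t \<ge> 0"
    and N: "a\<^sup>2 + card A * b\<^sup>2 + card B * (s\<^sup>2 + t\<^sup>2) = N" "N > 0"
    and q: "m * N = 2 * (card A * (a * b) + card B * (a * s + s * t))"
    and m: "m > 0" "m ^ 4 \<ge> 4 / 3 * card S" for a b s t m N :: real
  proof -
    note bounds = spider_quadratic_form_ge[OF sp sym w]
    obtain z where z: "(\<Sum>v\<in>S. (z v)\<^sup>2) = 1"
        "(\<Sum>u\<in>S. \<Sum>v\<in>S. of_bool (E u v) * z u * z v) \<ge> m"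
      using unit_vector_of_rayleigh_quotient[OF N(2) bounds(1)[unfolded N(1)] bounds(2)[folded q]] by blast
    have "m ^ 4 \<le> (\<Sum>u\<in>S. \<Sum>v\<in>S. of_bool (E u v) * z u * z v) ^ 4"
      using m(1) z(2) by (intro power_mono) auto
    then show thesis using result[OF z(1)] z(2) m by linarith
  qed
  show thesis
  proof (cases "3 * d\<^sup>2 \<ge> 4 * (1 + d + card B)")
    case True
    have "real (4 * (1 + d + card B)) \<le> real (3 * d\<^sup>2)" using True of_nat_mono by blast
    moreover have "sqrt d ^ 4 = (real d)\<^sup>2" using power_mult[of "sqrt d" 2 2] by simp
    ultimately have "sqrt d ^ 4 \<ge> 4 / 3 * card S" unfolding S by simp
    moreover have "real d = card A + card B" by (simp add: d_def)
    ultimately show thesis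
      using d by (intro conclude[of "sqrt d" 1 1 0 "2 * d" "sqrt d"]) (auto simp: algebra_simps)
  next
    case False
    have "d < 4"
    proof (rule ccontr)
      assume "\<not> d < 4"
      then have "4 * d \<le> d * d" by simp
      have "4 * (1 + d + card B) \<le> 4 * (1 + d + d)" by (simp add: d_def)
      also have "\<dots> \<le> 3 * (4 * d)" using \<open>\<not> d < 4\<close> by simp
      also have "\<dots> \<le> 3 * (d * d)" using \<open>4 * d \<le> d * d\<close> by (rule mult_left_mono) simp
      finally show False using False unfolding power2_eq_square by blast
    qed
    with d consider "d = 2" | "d = 3" by linarith
    then have "card A = 1 \<and> card B = 1 \<or> card A = 0 \<and> card B = 2 \<or> card A = 0 \<and> card B = 3"
      using False by cases (auto simp: d_def)
    then consider "card A = 1 \<and> card B = 1" | "card A = 0 \<and> card B = 2" | "card A = 0 \<and> card B = 3"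
      by (elim disjE) simp_all
    then show thesis
    proof cases
      case 1
      then show thesis using card_spider[OF sp]
        by (intro conclude[of 2 1 2 1 10 "8 / 5"]) (auto simp: power_divide)
    next
      case 2
      then show thesis using card_spider[OF sp]
        by (intro conclude[of 2 1 2 1 14 "12 / 7"]) (auto simp: power_divide)
    next
      case 3
      then show thesis using card_spider[OF sp]
        by (intro conclude[of 3 1 2 1 24 2]) (auto simp: power_divide)
    qed
  qed
qed

section \<open>Partitioning a connected graph into spiders\<close>

lemma path3_is_spider:
  assumes "E u y" "E u v" "u \<noteq> y" "u \<noteq> v" "y \<noteq> v"
  shows "is_spider E {u, y, v}"
  by (rule is_spiderI[of _ u "{y, v}" "{}" undefined]) (use assms in \<open>auto simp: spider_def\<close>)

text \<open>
  After a long leg is cut off at the centre, what is left is again a spider, possibly around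
  another centre.  The exception is the path on four vertices, where only one edge would be left.
\<close>

lemma spider_remove_long_leg:
  assumes sp: "spider E c A B g S" and sym: "symp E" and y: "y \<in> B"
  shows "is_spider E (S - {y, g y}) \<or> (\<exists>z. A = {z} \<and> B = {y})"
proof (cases "card A + card B \<ge> 3")
  case True
  have "spider E c A (B - {y}) g (S - {y, g y})"
    using sp y True unfolding spider_def by (auto simp: inj_on_def card_Diff_singleton)
  then show ?thesis by (blast intro: is_spiderI)
next
  case False
  then have two: "card A + card B = 2" using sp by (simp add: spider_def)
  have fin: "finite A" "finite B" using sp by (auto simp: spider_def)
  have "card B \<noteq> 0" using y fin by auto
  then consider "card A = 1" "card B = 1" | "card A = 0" "card B = 2" using two by linarith
  then show ?thesis
  proof cases
    case 1
    then show ?thesis using y by (auto simp: card_1_singleton_iff)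
  next
    case 2
    then obtain z where z: "B = {y, z}" "y \<noteq> z" using y by (auto simp: card_2_iff)
    have A: "A = {}" using 2 fin by auto
    have "S - {y, g y} = {z, c, g z}" using sp z A by (auto simp: spider_def inj_on_def)
    moreover have "is_spider E {z, c, g z}"
      using sp z sympD[OF sym, of c z] by (intro path3_is_spider) (auto simp: spider_def)
    ultimately show ?thesis by simp
  qed
qed

text \<open>
  If \<open>v\<close> is attached to the centre or to the end of a short leg, the spider simply grows.  If it is
  attached to a long leg, that leg together with \<open>v\<close> is a path on three vertices with middle
  vertex \<open>u\<close>, and it is split off.  When the rest would be a single edge, the spider was a path on
  four vertices, and moving the centre to a vertex of the long leg makes room for \<open>v\<close>.
\<close>

lemma spider_attach_vertex:
  assumes sp: "spider E c A B g S" and sym: "symp E"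
    and u: "u \<in> S" and v: "v \<notin> S" and uv: "E u v"
  shows "is_spider E (insert v S) \<or>
    (\<exists>S1 S2. is_spider E S1 \<and> is_spider E S2 \<and> S1 \<inter> S2 = {} \<and> S1 \<union> S2 = insert v S)"
proof -
  note parts = sp[unfolded spider_def]
  have S: "S = insert c (A \<union> B \<union> g ` B)" using parts by blast
  (* Here w is the other vertex of the long leg at y to which u belongs. *)
  have split: ?thesis if y: "y \<in> B" "{u, w} = {y, g y}"
    and short: "\<And>z. A = {z} \<Longrightarrow> B = {y} \<Longrightarrow> is_spider E (insert v S)" for y w
  proof -
    have leg: "{y, g y} \<subseteq> S" "y \<noteq> g y" "E y (g y)"
      using parts y(1) by blast+
    have "is_spider E {u, w, v}"
      using y(2) leg v uv sympD[OF sym leg(3)]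
      by (intro path3_is_spider) (auto simp: doubleton_eq_iff)
    moreover have "(S - {y, g y}) \<inter> {u, w, v} = {}" "(S - {y, g y}) \<union> {u, w, v} = insert v S"
      using y(2) leg(1) v by (auto simp: doubleton_eq_iff)
    ultimately show ?thesis
      using spider_remove_long_leg[OF sp sym y(1)] short by blast
  qed
  consider "u = c" | "u \<in> A" | "u \<in> B" | y where "y \<in> B" "u = g y"
    using u S by blast
  then show ?thesis
  proof cases
    case 1
    have "spider E c (insert v A) B g (insert v S)"
      using sp v uv 1 by (auto simp: spider_def)
    then show ?thesis by (blast intro: is_spiderI)
  next
    case 2
    have "spider E c (A - {u}) (insert u B) (g(u := v)) (insert v S)"
      unfolding spider_def
    proof (intro conjI)
      have "v \<notin> g ` B" "v \<notin> A" "v \<notin> B" "v \<noteq> c" "u \<notin> B" "u \<noteq> c" "u \<notin> g ` B"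
        using parts v 2 by blast+
      note distinct = this
      have img: "(g(u := v)) ` insert u B = insert v (g ` B)" using distinct by auto
      show "c \<notin> (A - {u}) \<union> insert u B" "(A - {u}) \<inter> insert u B = {}"
        "\<forall>y\<in>(A - {u}) \<union> insert u B. E c y" using parts distinct 2 by blast+
      show "finite (A - {u})" "finite (insert u B)" using parts by auto
      show "inj_on (g(u := v)) (insert u B)" using parts distinct
        by (auto simp: inj_on_def)
      show "(g(u := v)) ` insert u B \<inter> insert c ((A - {u}) \<union> insert u B) = {}"
        unfolding img using parts distinct 2 by blast
      show "\<forall>y\<in>insert u B. E y ((g(u := v)) y)" using parts distinct uv by auto
      have "card (A - {u}) + card (insert u B) = card A + card B"
        using parts distinct 2 card_Suc_Diff1[of A u] by simp
      then show "2 \<le> card (A - {u}) + card (insert u B)" using parts by simp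
      show "insert v S = insert c (A - {u} \<union> insert u B \<union> (g(u := v)) ` insert u B)"
        unfolding img S using 2 by blast
    qed
    then show ?thesis by (blast intro: is_spiderI)
  next
    case 3
    show ?thesis
    proof (rule split)
      show "u \<in> B" "{u, g u} = {u, g u}" using 3 by auto
      fix z assume "A = {z}" "B = {u}"
      then have "spider E u {g u, v} {c} (\<lambda>_. z) (insert v S)"
        using parts v uv 3 sympD[OF sym, of c u] by (auto simp: spider_def)
      then show "is_spider E (insert v S)" by (rule is_spiderI)
    qed
  next
    case 4
    show ?thesis
    proof (rule split)
      show "y \<in> B" "{u, y} = {y, g y}" using 4 by auto
      fix z assume "A = {z}" "B = {y}"
      then have "spider E y {} {c, u} ((\<lambda>_. v)(c := z)) (insert v S)"
        using parts v uv 4 sympD[OF sym, of c y] by (auto simp: spider_def)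
      then show "is_spider E (insert v S)" by (rule is_spiderI)
    qed
  qed
qed

text \<open>
  A largest set of vertices that is a disjoint union of spiders must be everything: otherwise an
  edge leaves it, and the outer end of that edge can be absorbed.  Three vertices are needed to
  have a spider to start with.
\<close>

lemma connected_spider_partition:
  assumes fin: "finite V" and card: "card V \<ge> 3"
    and sym: "symp E"
    and conn: "\<And>U. U \<subset> V \<Longrightarrow> U \<noteq> {} \<Longrightarrow> \<exists>u\<in>U. \<exists>v\<in>V - U. E u v"
  obtains P where "partition_on V P" "\<And>S. S \<in> P \<Longrightarrow> is_spider E S"
proof -
  define good where "good U \<longleftrightarrow> U \<subseteq> V \<and> U \<noteq> {} \<and> (\<exists>P. partition_on U P \<and> (\<forall>S\<in>P. is_spider E S))" for U
  obtain r where r: "r \<in> V" using card by fastforce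
  obtain s where s: "s \<in> V" "E r s" "r \<noteq> s"
    using conn[of "{r}"] r card by force
  have "{r, s} \<noteq> V" using card s(3) by auto
  then obtain t0 t where t: "t0 \<in> {r, s}" "t \<in> V" "t \<notin> {r, s}" "E t0 t"
    using conn[of "{r, s}"] r s by blast
  have "is_spider E {r, s, t}"
  proof (cases "t0 = r")
    case True
    then show ?thesis using s t by (intro path3_is_spider) auto
  next
    case False
    then have "is_spider E {s, r, t}" using s t sympD[OF sym, of r s] by (intro path3_is_spider) auto
    then show ?thesis by (simp add: insert_commute)
  qed
  then have "good {r, s, t}"
    unfolding good_def using r s t by (intro conjI exI[of _ "{{r, s, t}}"]) (auto simp: partition_on_def)
  moreover have "\<forall>U. good U \<longrightarrow> card U < Suc (card V)"
    using fin by (auto simp: good_def less_Suc_eq_le intro: card_mono)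
  ultimately obtain U where U: "good U" and max: "\<And>U'. good U' \<Longrightarrow> card U' \<le> card U"
    using ex_has_greatest_nat[of good "{r, s, t}" card "Suc (card V)"] by auto
  obtain P where P: "partition_on U P" "\<And>S. S \<in> P \<Longrightarrow> is_spider E S"
    using U by (auto simp: good_def)
  have "U = V"
  proof (rule ccontr)
    assume "U \<noteq> V"
    then obtain u v where uv: "u \<in> U" "v \<in> V" "v \<notin> U" "E u v"
      using conn[of U] U by (auto simp: good_def)
    obtain S where S: "S \<in> P" "u \<in> S" using P(1) uv(1) by (auto simp: partition_on_def)
    have SU: "S \<subseteq> U" using S P(1) by (auto simp: partition_on_def)
    have vS: "v \<notin> S" using SU uv(3) by auto
    have rest: "partition_on (U - S) (P - {S})"
      using P(1) S(1) by (auto simp: partition_on_def disjoint_def)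
    obtain c A B g where sp: "spider E c A B g S" using P(2)[OF S(1)] by (auto simp: is_spider_def)
    have ins: "(U - S) \<union> insert v S = insert v U" using SU by auto
    have ne: "S' \<noteq> {}" if "is_spider E S'" for S' using that by (auto simp: is_spider_def spider_def)
    have "\<exists>Q. partition_on (insert v S) Q \<and> (\<forall>S'\<in>Q. is_spider E S')"
      using spider_attach_vertex[OF sp sym S(2) vS uv(4)]
    proof (elim disjE exE conjE)
      assume "is_spider E (insert v S)"
      then show ?thesis by (intro exI[of _ "{insert v S}"]) (auto simp: partition_on_def)
    next
      fix S1 S2 assume *: "is_spider E S1" "is_spider E S2" "S1 \<inter> S2 = {}" "S1 \<union> S2 = insert v S"
      then show ?thesis using ne[OF *(1)] ne[OF *(2)]
        by (intro exI[of _ "{S1, S2}"]) (auto simp: partition_on_def disjoint_def)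
    qed
    then obtain Q where Q: "partition_on (insert v S) Q" "\<And>S'. S' \<in> Q \<Longrightarrow> is_spider E S'" by blast
    have "partition_on ((U - S) \<union> insert v S) ((P - {S}) \<union> Q)"
    proof (rule partition_onI)
      have "\<Union> (P - {S}) = U - S" "\<Union> Q = insert v S"
        using rest Q(1) by (auto simp: partition_on_def)
      then show "\<Union> ((P - {S}) \<union> Q) = (U - S) \<union> insert v S"
        and "\<And>S1 S2. S1 \<in> (P - {S}) \<union> Q \<Longrightarrow> S2 \<in> (P - {S}) \<union> Q \<Longrightarrow> S1 \<noteq> S2 \<Longrightarrow> disjnt S1 S2"
        using disjoint_union[OF partition_onD2[OF rest] partition_onD2[OF Q(1)]] uv(3)
        by (auto simp: disjoint_def disjnt_def)
      show "{} \<notin> (P - {S}) \<union> Q"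
        using rest Q(1) by (auto simp: partition_on_def)
    qed
    then have "good (insert v U)"
      unfolding good_def using U P(2) Q(2) uv ins by (auto simp: good_def)
    from max[OF this] show False
      using uv(3) U fin by (auto simp: good_def card_insert_if finite_subset)
  qed
  then show thesis using that P by blast
qed

section \<open>Eigenvalues of graphs\<close>

text \<open>
  The spectral theorem transported from matrix indices to vertices, so that the sets and test
  vectors below need no enumeration of the vertices.
\<close>

lemma graph_spectral_decomposition:
  assumes "Digraph.graph G"
  obtains d :: "nat \<Rightarrow> real" and U :: "'a \<Rightarrow> nat \<Rightarrow> real" and n
  where "graph_eigenvalues G = image_mset d (mset_set {..<n})"
    and "\<And>u v. u \<in> verts G \<Longrightarrow> v \<in> verts G \<Longrightarrow>
      of_bool (u \<rightarrow>\<^bsub>G\<^esub> v) = (\<Sum>j<n. d j * U u j * U v j)"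
    and "\<And>u v. u \<in> verts G \<Longrightarrow> v \<in> verts G \<Longrightarrow> (\<Sum>j<n. U u j * U v j) = of_bool (u = v)"
    and "\<And>j. j < n \<Longrightarrow> (\<Sum>v\<in>verts G. (U v j)\<^sup>2) = 1"
proof -
  interpret Digraph.graph G by fact
  define vs n A where "vs = vertex_list G" and "n = length vs" and "A = adjacency_matrix G vs"
  have bij: "bij_betw ((!) vs) {..<n} (verts G)"
    using vertex_list[of G] by (auto simp: vs_def n_def intro!: bij_betw_nth)
  define idx where "idx = inv_into {..<n} ((!) vs)"
  have idx: "idx v < n" "vs ! idx v = v" if "v \<in> verts G" for v
    using that bij bij_betw_inv_into[OF bij] bij_betw_inv_into_right[OF bij]
    by (auto simp: idx_def bij_betw_def)
  have idx_nth: "idx (vs ! i) = i" if "i < n" for i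
    using that bij_betw_inv_into_left[OF bij] by (auto simp: idx_def)
  have A: "A \<in> carrier_mat n n" by (auto simp: A_def adjacency_matrix_def n_def)
  have "transpose_mat A = A"
    by (rule eq_matI) (auto simp: A_def adjacency_matrix_def intro: graph_symmetric)
  from real_spectral_theorem[OF A this] obtain W d where W: "W \<in> carrier_mat n n"
      "W * transpose_mat W = 1\<^sub>m n" "A = W * mat_diag n d * transpose_mat W"
    by blast
  have WW': "transpose_mat W * W = 1\<^sub>m n"
    using mat_mult_left_right_inverse[OF W(1) _ W(2)] W(1) by simp
  define U where "U v j = W $$ (idx v, j)" for v j
  show thesis
  proof
    show "graph_eigenvalues G = image_mset d (mset_set {..<n})"
      unfolding graph_eigenvalues_def vs_def[symmetric] A_def[symmetric] W(3)
      by (rule proots_char_poly_diagonalisation[OF W(1,2)])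
  next
    fix u v assume uv: "u \<in> verts G" "v \<in> verts G"
    have "of_bool (u \<rightarrow>\<^bsub>G\<^esub> v) = A $$ (idx u, idx v)"
      using idx uv by (simp add: A_def adjacency_matrix_def n_def)
    also have "\<dots> = (W * mat_diag n d * transpose_mat W) $$ (idx u, idx v)"
      using W(3) by simp
    also have "\<dots> = (\<Sum>j<n. d j * U u j * U v j)"
      using W(1) idx uv
      by (simp add: mat_diag_mult_right[of _ n n] scalar_prod_def atLeast0LessThan U_def mult_ac)
    finally show "of_bool (u \<rightarrow>\<^bsub>G\<^esub> v) = (\<Sum>j<n. d j * U u j * U v j)" .
    have "(\<Sum>j<n. U u j * U v j) = (W * transpose_mat W) $$ (idx u, idx v)"
      using W(1) idx uv by (simp add: scalar_prod_def atLeast0LessThan U_def)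
    also have "\<dots> = of_bool (idx u = idx v)" unfolding W(2) using idx uv by simp
    also have "idx u = idx v \<longleftrightarrow> u = v" using idx uv by metis
    finally show "(\<Sum>j<n. U u j * U v j) = of_bool (u = v)" .
  next
    fix j assume j: "j < n"
    have "(\<Sum>v\<in>verts G. (U v j)\<^sup>2) = (\<Sum>i<n. (U (vs ! i) j)\<^sup>2)"
      by (rule sum.reindex_bij_betw[OF bij, symmetric])
    also have "\<dots> = (transpose_mat W * W) $$ (j, j)"
      using W(1) j by (simp add: scalar_prod_def atLeast0LessThan U_def idx_nth power2_eq_square)
    also have "\<dots> = 1" unfolding WW' using j by simp
    finally show "(\<Sum>v\<in>verts G. (U v j)\<^sup>2) = 1" .
  qed
qed

lemma positive_energy_eq_sum:
  assumes "graph_eigenvalues G = image_mset d (mset_set {..<n::nat})"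
  shows "positive_energy p G = (\<Sum>j<n. if d j > 0 then d j powr p else 0)"
proof -
  have "positive_energy p G = (\<Sum>j\<in>{j\<in>{..<n}. d j > 0}. d j powr p)"
    unfolding positive_energy_def assms
    by (simp add: filter_mset_image_mset image_mset.compositionality o_def sum_unfold_sum_mset)
  also have "\<dots> = (\<Sum>j<n. if d j > 0 then d j powr p else 0)"
    by (rule sum.inter_filter) simp
  finally show ?thesis .
qed

lemma connected_graph_crossing_edge:
  assumes "Digraph.graph G" "Digraph_Component.connected G" "U \<subset> verts G" "U \<noteq> {}"
  shows "\<exists>u\<in>U. \<exists>v\<in>verts G - U. u \<rightarrow>\<^bsub>G\<^esub> v"
proof -
  interpret Digraph.graph G by fact
  obtain a b where ab: "a \<in> U" "b \<in> verts G" "b \<notin> U" using assms by blast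
  have "strongly_connected G"
    using assms(2) sym_arcs by (rule symmetric_connected_imp_strongly_connected[rotated])
  then have "a \<rightarrow>\<^sup>*\<^bsub>G\<^esub> b" using ab assms(3) by (auto simp: strongly_connected_def)
  from this ab show ?thesis
  proof (induction rule: reachable_induct)
    case (step x y)
    then show ?case by (cases "x \<in> U") (use reachable_in_verts in auto)
  qed simp
qed

theorem theorem2:
  fixes G :: "('a, 'b) pre_digraph" and p :: real
  assumes "p \<ge> 4"
    and "Digraph.graph G"
    and "Digraph_Component.connected G"
    and "card (verts G) \<ge> 4"
  shows "positive_energy p G \<ge> (4 / 3) powr (p / 4) * real (card (verts G))"
proof -
  interpret Digraph.graph G by fact
  define E where "E u v \<longleftrightarrow> u \<rightarrow>\<^bsub>G\<^esub> v" for u v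
  have sym: "symp E" using graph_symmetric by (auto simp: E_def symp_def)
  obtain P where P: "partition_on (verts G) P" "\<And>S. S \<in> P \<Longrightarrow> is_spider E S"
    using connected_spider_partition[of "verts G" E] sym assms(4)
      connected_graph_crossing_edge[OF assms(2,3)] by (auto simp: E_def)
  define \<mu> where "\<mu> y S = (\<Sum>u\<in>S. \<Sum>v\<in>S. of_bool (E u v) * y u * y v)" for y :: "'a \<Rightarrow> real" and S
  have "\<forall>S\<in>P. \<exists>y. (\<Sum>v\<in>S. (y v)\<^sup>2) = 1 \<and> \<mu> y S > 0 \<and> \<mu> y S ^ 4 \<ge> 4 / 3 * card S"
  proof
    fix S assume "S \<in> P"
    then obtain c A B g where "spider E c A B g S" using P(2) unfolding is_spider_def by meson
    then show "\<exists>y. (\<Sum>v\<in>S. (y v)\<^sup>2) = 1 \<and> \<mu> y S > 0 \<and> \<mu> y S ^ 4 \<ge> 4 / 3 * card S"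
      unfolding \<mu>_def by (rule spider_rayleigh_bound[OF _ sym]) blast
  qed
  from bchoice[OF this] obtain x where x: "\<And>S. S \<in> P \<Longrightarrow> (\<Sum>v\<in>S. (x S v)\<^sup>2) = 1"
      "\<And>S. S \<in> P \<Longrightarrow> \<mu> (x S) S > 0" "\<And>S. S \<in> P \<Longrightarrow> \<mu> (x S) S ^ 4 \<ge> 4 / 3 * card S"
    by blast
  have spider_energy: "(4 / 3) powr (p / 4) * card S \<le> \<mu> (x S) S powr p" if S: "S \<in> P" for S
  proof -
    obtain c A B g where "spider E c A B g S" using P(2)[OF S] by (auto simp: is_spider_def)
    then have card: "real (card S) \<ge> 1" by (simp add: card_spider)
    have "(4 / 3) powr (p / 4) * real (card S) powr 1 \<le> (4 / 3) powr (p / 4) * real (card S) powr (p / 4)"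
      using card assms(1) by (intro mult_left_mono powr_mono) auto
    also have "\<dots> = (4 / 3 * card S) powr (p / 4)" by (subst powr_mult) auto
    also have "\<dots> \<le> (\<mu> (x S) S ^ 4) powr (p / 4)"
      using x(3)[OF S] assms(1) by (intro powr_mono2) auto
    also have "\<dots> = \<mu> (x S) S powr p"
      using x(2)[OF S] by (simp add: powr_powr flip: powr_numeral)
    finally show ?thesis using card by simp
  qed
  have "card (verts G) = (\<Sum>S\<in>P. card S)"
    unfolding partition_onD1[OF P(1)]
  proof (rule card_Union_disjoint)
    show "disjoint P" by (rule partition_onD2[OF P(1)])
    show "finite S" if "S \<in> P" for S
      using that partition_onD1[OF P(1)] finite_verts by (metis Union_upper finite_subset)
  qed
  then have "(4 / 3) powr (p / 4) * real (card (verts G)) = (\<Sum>S\<in>P. (4 / 3) powr (p / 4) * card S)"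
    by (simp add: sum_distrib_left)
  also have "\<dots> \<le> (\<Sum>S\<in>P. \<mu> (x S) S powr p)" by (rule sum_mono[OF spider_energy])
  finally have partition_energy:
    "(4 / 3) powr (p / 4) * real (card (verts G)) \<le> (\<Sum>S\<in>P. \<mu> (x S) S powr p)" .
  show ?thesis
  proof (rule graph_spectral_decomposition[OF assms(2)])
    fix d :: "nat \<Rightarrow> real" and U :: "'a \<Rightarrow> nat \<Rightarrow> real" and n
    assume spec:
      "graph_eigenvalues G = image_mset d (mset_set {..<n})"
      "\<And>u v. u \<in> verts G \<Longrightarrow> v \<in> verts G \<Longrightarrow> of_bool (u \<rightarrow>\<^bsub>G\<^esub> v) = (\<Sum>j<n. d j * U u j * U v j)"
      "\<And>u v. u \<in> verts G \<Longrightarrow> v \<in> verts G \<Longrightarrow> (\<Sum>j<n. U u j * U v j) = of_bool (u = v)"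
      "\<And>j. j < n \<Longrightarrow> (\<Sum>v\<in>verts G. (U v j)\<^sup>2) = 1"
    note partition_energy
    also have "(\<Sum>S\<in>P. \<mu> (x S) S powr p) \<le> (\<Sum>j<n. if d j > 0 then d j powr p else 0)"
      unfolding \<mu>_def
    proof (rule sum_powr_rayleigh_le_positive_power_sum[where V = "verts G" and U = U])
      show "of_bool (E u v) = (\<Sum>j\<in>{..<n}. d j * U u j * U v j)"
        if "u \<in> verts G" "v \<in> verts G" for u v
        using spec(2)[OF that] by (simp add: E_def)
      show "(\<Sum>v\<in>verts G. (U v j)\<^sup>2) \<le> 1" if "j \<in> {..<n}" for j
        using spec(4)[of j] that by simp
      show "0 < (\<Sum>u\<in>S. \<Sum>v\<in>S. of_bool (E u v) * x S u * x S v)" if "S \<in> P" for S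
        using x(2)[OF that] by (simp add: \<mu>_def)
    qed (use P(1) assms(1) spec(3) x(1) in auto)
    also have "\<dots> = positive_energy p G" by (rule positive_energy_eq_sum[OF spec(1), symmetric])
    finally show ?thesis .
  qed
qed

end
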